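(* Let $k$ be an odd positive integer such that $5k+2$ is prime. If $k\equiv 0\pmod 3$ and the number $\frac{2(5k+3)}{3}$ is a period of the Fibonacci sequence modulo $5k+2$, then the following three congruences are equivalent: $$F_{5k+3}\equiv 0\pmod{5k+2},\qquad F_{\frac{5k+3}{3}}\equiv 0\pmod{5k+2},\qquad F_{\frac{2(5k+3)}{3}}\equiv 0\pmod{5k+2}.$$ Moreover, if $k\equiv 0\pmod 3$ and $F_{\frac{5k+3}{3}}\equiv 0\pmod{5k+2}$, then the number $\frac{2(5k+3)}{3}$ is a period of the Fibonacci sequence modulo $5k+2$ if and only if $F_{\frac{5k}{3}}\equiv -1\pmod{5k+2}$.
   Context: $(F_n)_{n\ge 0}$ denotes the Fibonacci sequence: $F_0=0$, $F_1=1$, $F_{n+2}=F_{n+1}+F_n$. For an integer $m\ge 2$, a period of the Fibonacci sequence modulo $m$ is a non-zero integer $\ell$ such that $F_{1+\ell}\equiv F_{2+\ell}\equiv 1\pmod m$. *)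

theory Defs
  imports "HOL-Number_Theory.Number_Theory"
begin

(* The Fibonacci sequence is indexed from 0, so l ranges over the naturals. The only negative
   integer for which both indices 1 + l and 2 + l would be defined is l = -1, and it is
   not a period, because F 0 = 0 is not congruent to 1 modulo m for m at least 2. *)
definition fib_period :: "nat \<Rightarrow> nat \<Rightarrow> bool" where
  "fib_period m l \<longleftrightarrow> l \<noteq> 0 \<and> [fib (1 + l) = 1] (mod m) \<and> [fib (2 + l) = 1] (mod m)"

end

theory Submission imports Defs begin

text \<open>
  Put \<open>n = (5 k + 3) / 3\<close> and \<open>p = 5 k + 2 = 3 n - 1\<close>; here \<open>n\<close> is even. If \<open>2 n\<close> is a period,
  then \<open>p\<close> divides \<open>F (2 n) = F n * L n\<close>, and Cassini's identity excludes \<open>p dvd L n\<close>; so \<open>p\<close>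
  divides \<open>F n\<close> and all three congruences hold. Conversely, if \<open>p\<close> divides \<open>F n\<close>, Cassini's
  identity gives \<open>F (n - 1)\<^sup>2 = 1\<close> modulo \<open>p\<close>, hence \<open>2 n\<close> is a period. Moreover
  \<open>L p = F (3 n) + (F (3 n) - F (3 n - 1)) = - F (n - 1) ^ 3 = - F (n - 1)\<close>, while the Lucas number
  \<open>L p\<close> is congruent to 1 modulo any prime \<open>p\<close>; so \<open>F (n - 1) = - 1\<close> also holds automatically.
\<close>

text \<open>Absorption turns \<open>(n - k) * (n - Suc k choose (k - 1))\<close> into
  \<open>k * (n - k choose k)\<close>. The factor \<open>n - k\<close> stays on the left to avoid a
  division.\<close>

lemma choose_add_choose_mult:
  assumes "0 < k" "k < n"
  shows "(n - k) * ((n - k choose k) + (n - Suc k choose (k - 1))) = n * (n - k choose k)"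
proof -
  obtain j where j: "k = Suc j" using assms by (cases k) auto
  obtain i where i: "n - k = Suc i" using assms by (metis Suc_diff_Suc)
  have "n - Suc k = i" using i by simp
  moreover have "n = Suc i + k" using i assms by simp
  moreover have "Suc i * (i choose j) = k * (Suc i choose k)"
    unfolding j using Suc_times_binomial_eq[of i j] by (simp add: mult.commute)
  ultimately show ?thesis by (simp add: i j algebra_simps)
qed

lemma prime_dvd_choose_add_choose:
  fixes p :: nat
  assumes "prime p" "0 < k" "k < p"
  shows "p dvd (p - k choose k) + (p - Suc k choose (k - 1))"
proof -
  have "p dvd (p - k) * ((p - k choose k) + (p - Suc k choose (k - 1)))"
    using choose_add_choose_mult[OF assms(2,3)] by simp
  moreover have "\<not> p dvd p - k" using assms by (auto dest: dvd_imp_le)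
  ultimately show ?thesis using assms(1) prime_dvd_mult_iff by blast
qed

text \<open>The left-hand side is the Lucas number \<open>L p\<close>. Expanding it along the diagonals of Pascal's
  triangle gives 1 plus the sum over \<open>0 < k < p\<close> of \<open>p / (p - k) * (p - k choose k)\<close>.\<close>

lemma prime_fib_lucas_cong:
  assumes "prime p"
  shows "[fib (Suc p) + fib (p - 1) = 1] (mod p)"
proof -
  obtain q where q: "p = Suc (Suc q)"
    using prime_ge_2_nat[OF assms] by (metis add_2_eq_Suc le_Suc_ex)
  have "fib (Suc p) = (\<Sum>k\<in>{0..p}. p - k choose k)"
    by (simp only: ne_diagonal_fib)
  also have "\<dots> = 1 + (\<Sum>k\<in>{1..p}. p - k choose k)"
    by (simp add: sum.atLeast_Suc_atMost)
  \<comment> \<open>The term at \<open>k = p\<close> is \<open>0 choose p = 0\<close>; dropping it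
    gives both diagonal sums the same range.\<close>
  also have "(\<Sum>k\<in>{1..p}. p - k choose k) = (\<Sum>k\<in>{1..Suc q}. p - k choose k)"
    unfolding q by simp
  finally have 1: "fib (Suc p) = 1 + (\<Sum>k\<in>{1..Suc q}. p - k choose k)" .
  have "fib (p - 1) = (\<Sum>k\<in>{0..q}. q - k choose k)"
    using q by (simp only: ne_diagonal_fib diff_Suc_1)
  also have "\<dots> = (\<Sum>k\<in>{1..Suc q}. p - Suc k choose (k - 1))"
    unfolding One_nat_def sum.shift_bounds_cl_Suc_ivl using q by simp
  finally have 2: "fib (p - 1) = (\<Sum>k\<in>{1..Suc q}. p - Suc k choose (k - 1))" .
  have "p dvd (\<Sum>k\<in>{1..Suc q}. (p - k choose k) + (p - Suc k choose (k - 1)))"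
    by (intro dvd_sum prime_dvd_choose_add_choose assms) (use q in auto)
  hence "p dvd (fib (Suc p) + fib (p - 1)) - 1"
    by (simp only: 1 2 sum.distrib add.assoc diff_add_inverse)
  \<comment> \<open>Fact \<open>1\<close> shows that the natural subtraction of 1 is not
    truncated.\<close>
  thus ?thesis
    using 1 by (metis add.assoc cong_def cong_altdef_nat le_add1)
qed

lemma fib_Suc_double: "fib (Suc (2 * n)) = fib (Suc n) ^ 2 + fib n ^ 2"
  using fib_add[of n n] by (simp add: power2_eq_square mult_2)

text \<open>The second factor is the Lucas number of index \<open>Suc m\<close>.\<close>

lemma fib_double_Suc: "fib (2 * Suc m) = fib (Suc m) * (2 * fib m + fib (Suc m))"
  using fib_rec_even'[of "Suc m"] by (simp add: mult.commute)

lemma fib_Suc_cassini_odd: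
  assumes "odd m"
  shows "int (fib m) ^ 2 + int (fib m) * int (fib (Suc m)) - int (fib (Suc m)) ^ 2 = 1"
  using fib_Cassini_int[of m] assms by (simp add: algebra_simps power2_eq_square)

lemma fib_period_double_imp_dvd_fib:
  assumes "prime p" "odd p" "odd m" and per: "fib_period p (2 * Suc m)"
  shows "p dvd fib (Suc m)"
proof -
  let ?a = "int (fib m)" and ?b = "int (fib (Suc m))"
  have c1: "[fib (Suc (2 * Suc m)) = 1] (mod p)"
    and c2: "[fib (Suc (2 * Suc m)) + fib (2 * Suc m) = 1] (mod p)"
    using per by (simp_all add: fib_period_def add.commute)
  have "[fib (Suc (2 * Suc m)) + fib (2 * Suc m) = fib (Suc (2 * Suc m)) + 0] (mod p)"
    using c1 c2 by (metis add.right_neutral cong_sym cong_trans)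
  hence "p dvd fib (2 * Suc m)"
    by (metis cong_add_lcancel_nat cong_0_iff)
  hence "p dvd fib (Suc m) \<or> p dvd 2 * fib m + fib (Suc m)"
    using assms(1) by (simp only: fib_double_Suc prime_dvd_mult_iff)
  \<comment> \<open>By Cassini, \<open>(2 * ?a + ?b) * (?a + ?b)\<close> exceeds
    \<open>(?a + ?b)^2 + ?b^2 - 1\<close> by exactly 2. If \<open>p\<close> divided the Lucas
    factor, it would divide both, hence 2, although it is odd.\<close>
  moreover have False if "p dvd 2 * fib m + fib (Suc m)"
  proof -
    have "int p dvd 2 * ?a + ?b"
      using that by (metis int_dvd_int_iff of_nat_add of_nat_mult of_nat_numeral)
    hence d: "int p dvd (2 * ?a + ?b) * (?a + ?b)" by simp
    have e: "int p dvd int (fib (Suc (2 * Suc m))) - 1"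
      using c1 by (metis cong_iff_dvd_diff cong_int_iff of_nat_1)
    have "int (fib (Suc (2 * Suc m))) = (?a + ?b)^2 + ?b^2"
      unfolding fib_Suc_double by (simp add: add.commute)
    hence "(2 * ?a + ?b) * (?a + ?b) - (int (fib (Suc (2 * Suc m))) - 1) = 2"
      using fib_Suc_cassini_odd[OF \<open>odd m\<close>] by (simp add: algebra_simps power2_eq_square)
    hence "int p dvd 2" using dvd_diff[OF d e] by (simp only:)
    hence "p dvd 2" by (metis int_dvd_int_iff of_nat_numeral)
    thus False using assms(1,2) by (metis primes_dvd_imp_eq two_is_prime_nat dvd_refl)
  qed
  ultimately show ?thesis by blast
qed

lemma dvd_fib_imp_fib_period_double:
  assumes "odd m" "p dvd fib (Suc m)"
  shows "fib_period p (2 * Suc m)"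
proof -
  let ?a = "int (fib m)" and ?b = "int (fib (Suc m))"
  have b: "int p dvd ?b" using assms by simp
  \<comment> \<open>Replacing 1 by Cassini's form \<open>?a^2 + ?a * ?b - ?b^2\<close> leaves a
    multiple of \<open>?b\<close>.\<close>
  have "int (fib (Suc (2 * Suc m))) - 1 = ?b * (?a + 3 * ?b)"
    unfolding fib_Suc_double using fib_Suc_cassini_odd[OF assms(1)]
    by (simp add: algebra_simps power2_eq_square)
  hence "int p dvd int (fib (Suc (2 * Suc m))) - 1" using b by simp
  hence 1: "[fib (Suc (2 * Suc m)) = 1] (mod p)"
    by (metis cong_iff_dvd_diff cong_int_iff of_nat_1)
  have "p dvd fib (2 * Suc m)" using assms(2) by (simp only: fib_double_Suc dvd_mult2)
  hence "[fib (Suc (2 * Suc m)) + fib (2 * Suc m) = 1 + 0] (mod p)"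
    by (intro cong_add 1) (simp add: cong_0_iff)
  thus ?thesis using 1 by (simp add: fib_period_def add.commute)
qed

lemma dvd_fib_imp_pred_cong:
  assumes "prime p" "odd m" "p dvd fib (Suc m)" and p: "Suc p = 3 * Suc m"
  shows "[int (fib m) = - 1] (mod int p)"
proof -
  let ?a = "int (fib m)" and ?b = "int (fib (Suc m))"
  have b: "[?b = 0] (mod int p)" using assms(3) by (simp add: cong_0_iff)
  \<comment> \<open>Split \<open>p\<close> as \<open>2 * Suc m + m\<close>: modulo \<open>p\<close>
    only the cube of \<open>?a\<close> will survive.\<close>
  have "fib p = fib (Suc (Suc (2 * m) + m))" using p by (intro arg_cong[of _ _ fib]) simp
  also have "\<dots> = fib (Suc m) * fib (2 * Suc m) + fib m * (fib (Suc m) ^ 2 + fib m ^ 2)"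
    by (subst fib_add) (simp add: fib_Suc_double)
  finally have F: "int (fib p) = ?b * int (fib (2 * Suc m)) + ?a * (?b^2 + ?a^2)"
    by (simp only: of_nat_add of_nat_mult of_nat_power)
  have "p dvd fib (Suc p)"
    using assms(3) fib_gcd[of "Suc m" "3 * Suc m"] unfolding p
    by (metis dvd_trans gcd_dvd2 gcd_nat.absorb1 dvd_triv_right)
  hence z: "[int (fib (Suc p)) = 0] (mod int p)" by (simp add: cong_0_iff)
  have "fib (Suc p) = fib p + fib (p - 1)"
    using prime_gt_0_nat[OF assms(1)] by (cases p) auto
  \<comment> \<open>Eliminating \<open>fib (p - 1)\<close> writes the Lucas number through
    \<open>fib (Suc p)\<close>, which vanishes modulo \<open>p\<close>, and
    \<open>fib p\<close>.\<close>
  hence "int (fib (Suc p) + fib (p - 1)) = 2 * int (fib (Suc p)) - int (fib p)" by simp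
  hence L: "[2 * int (fib (Suc p)) - int (fib p) = 1] (mod int p)"
    using prime_fib_lucas_cong[OF assms(1)] by (metis cong_int_iff of_nat_1)
  have "[int (fib p) = 0 * int (fib (2 * Suc m)) + ?a * (0^2 + ?a^2)] (mod int p)"
    unfolding F by (intro cong_add cong_mult cong_pow b cong_refl)
  hence a3: "[int (fib p) = ?a * ?a^2] (mod int p)" by simp
  have "[?a^2 + ?a * 0 - 0^2 = ?a^2 + ?a * ?b - ?b^2] (mod int p)"
    by (intro cong_add cong_diff cong_mult cong_pow cong_sym[OF b] cong_refl)
  hence "[?a^2 = 1] (mod int p)" unfolding fib_Suc_cassini_odd[OF assms(2)] by simp
  hence "[?a * ?a^2 = ?a * 1] (mod int p)" by (intro cong_mult cong_refl)
  hence "[int (fib p) = ?a] (mod int p)" using a3 cong_trans by fastforce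
  hence "[2 * int (fib (Suc p)) - int (fib p) = 2 * 0 - ?a] (mod int p)"
    by (intro cong_diff cong_mult z cong_refl)
  hence "[- ?a = 1] (mod int p)" using L by (metis cong_sym cong_trans mult_zero_right diff_0)
  thus ?thesis using cong_minus_minus_iff by fastforce
qed

theorem theorem5p33:
  fixes k :: nat
  assumes "k > 0" and "odd k" and "prime (5 * k + 2)"
  shows "([k = 0] (mod 3) \<and> fib_period (5 * k + 2) (2 * (5 * k + 3) div 3) \<longrightarrow>
            ([fib (5 * k + 3) = 0] (mod (5 * k + 2)) \<longleftrightarrow>
             [fib ((5 * k + 3) div 3) = 0] (mod (5 * k + 2))) \<and>
            ([fib ((5 * k + 3) div 3) = 0] (mod (5 * k + 2)) \<longleftrightarrow>
             [fib (2 * (5 * k + 3) div 3) = 0] (mod (5 * k + 2)))) \<and>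
         ([k = 0] (mod 3) \<and> [fib ((5 * k + 3) div 3) = 0] (mod (5 * k + 2)) \<longrightarrow>
            (fib_period (5 * k + 2) (2 * (5 * k + 3) div 3) \<longleftrightarrow>
             [int (fib (5 * k div 3)) = - 1] (mod int (5 * k + 2))))"
proof (cases "[k = 0] (mod 3)")
  case True
  then obtain j where j: "k = 3 * j" by (auto simp: cong_0_iff)
  define m where "m = 5 * j"
  define p where "p = 5 * k + 2"
  have "odd m" "odd p" "prime p" using assms by (auto simp: m_def p_def j)
  have p: "Suc p = 3 * Suc m" by (simp add: p_def m_def j)
  have eqs: "5 * k + 3 = 3 * Suc m" "3 * Suc m div 3 = Suc m"
    "2 * (3 * Suc m) div 3 = 2 * Suc m" "5 * k div 3 = m"
    by (simp_all add: m_def j)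
  \<comment> \<open>Used with \<open>l = 2\<close> and \<open>l = 3\<close>, for the other two
    Fibonacci numbers.\<close>
  have "p dvd fib (l * Suc m)" if "p dvd fib (Suc m)" for l
    using that fib_gcd[of "Suc m" "l * Suc m"]
    by (metis dvd_trans gcd_dvd2 gcd_nat.absorb1 dvd_triv_right)
  thus ?thesis
    unfolding eqs p_def[symmetric] cong_0_iff
    using fib_period_double_imp_dvd_fib[OF \<open>prime p\<close> \<open>odd p\<close> \<open>odd m\<close>]
      dvd_fib_imp_fib_period_double[OF \<open>odd m\<close>]
      dvd_fib_imp_pred_cong[OF \<open>prime p\<close> \<open>odd m\<close> _ p]
    by blast
qed simp

end
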